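(* Let $(X,r)$ be a left non-degenerate solution, let $(X,\triangleright_r)$ be its associated left shelf with left multiplications $L_x(y)=x\triangleright_r y$, and let $\kappa:X\to X$ be a $\lambda$-centralizing map. Then $\kappa$ is a reflection for $(X,r)$ if and only if, for all $x,y\in X$, the following hold: 1. $\kappa L_x=\kappa L_{\kappa(x)}$; 2. $\kappa L_{L_x(y)}(x)=L_{\kappa L_x(y)}\,\kappa(x)$.
   Context: A (set-theoretic) solution (of the Yang-Baxter equation) is a pair $(X,r)$ with $X$ a set and $r:X\times X\to X\times X$ a map satisfying $(r\times \mathrm{id}_X)(\mathrm{id}_X\times r)(r\times \mathrm{id}_X)=(\mathrm{id}_X\times r)(r\times \mathrm{id}_X)(\mathrm{id}_X\times r)$. Write $r(x,y)=(\lambda_x(y),\rho_y(x))$. The solution is left non-degenerate if every $\lambda_x:X\to X$ is bijective. A reflection for $(X,r)$ is a map $\kappa:X\to X$ with $r(\mathrm{id}_X\times\kappa)r(\mathrm{id}_X\times\kappa)=(\mathrm{id}_X\times\kappa)r(\mathrm{id}_X\times\kappa)r$. A map $\kappa:X\to X$ is $\lambda$-centralizing if $\lambda_x\kappa=\kappa\lambda_x$ for all $x\in X$. Juxtaposition of maps denotes composition. A left shelf $(X,\triangleright)$ is a set with a binary operation satisfying $x\triangleright(y\triangleright z)=(x\triangleright y)\triangleright(x\triangleright z)$ for all $x,y,z$. If $(X,r)$ is a left non-degenerate solution, its associated left shelf is $(X,\triangleright_r)$ with $x\triangleright_r y:=\lambda_x\rho_{\lambda_y^{-1}(x)}(y)$.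 *)

theory Defs
  imports Main "HOL-Library.FuncSet"
begin

text \<open>
  The set X is an explicit carrier (possibly empty) in an ambient type. A map between carriers is
  a function of the ambient types, and two maps are equal when they agree on the carrier.
\<close>

text \<open>The product \<open>X \<times> X \<times> X\<close> is nested to the right, so \<open>r \<times> id\<close> needs a reassociation,
  while \<open>id \<times> r\<close> is \<open>map_prod id r\<close>.\<close>

definition map_12 :: "('a \<times> 'a \<Rightarrow> 'a \<times> 'a) \<Rightarrow> 'a \<times> 'a \<times> 'a \<Rightarrow> 'a \<times> 'a \<times> 'a" where
  "map_12 r = (\<lambda>(x, y, z). (fst (r (x, y)), snd (r (x, y)), z))"

definition map_23 :: "('a \<times> 'a \<Rightarrow> 'a \<times> 'a) \<Rightarrow> 'a \<times> 'a \<times> 'a \<Rightarrow> 'a \<times> 'a \<times> 'a" where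
  "map_23 r = map_prod id r"

definition yb_solution :: "'a set \<Rightarrow> ('a \<times> 'a \<Rightarrow> 'a \<times> 'a) \<Rightarrow> bool" where
  "yb_solution X r \<longleftrightarrow>
     r \<in> X \<times> X \<rightarrow> X \<times> X \<and>
     (\<forall>t \<in> X \<times> X \<times> X.
        (map_12 r \<circ> map_23 r \<circ> map_12 r) t = (map_23 r \<circ> map_12 r \<circ> map_23 r) t)"

text \<open>\<open>r (x, y) = (lambda_map r x y, rho_map r y x)\<close>\<close>

definition lambda_map :: "('a \<times> 'a \<Rightarrow> 'a \<times> 'a) \<Rightarrow> 'a \<Rightarrow> 'a \<Rightarrow> 'a" where
  "lambda_map r x y = fst (r (x, y))"

definition rho_map :: "('a \<times> 'a \<Rightarrow> 'a \<times> 'a) \<Rightarrow> 'a \<Rightarrow> 'a \<Rightarrow> 'a" where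
  "rho_map r y x = snd (r (x, y))"

definition left_nondegenerate :: "'a set \<Rightarrow> ('a \<times> 'a \<Rightarrow> 'a \<times> 'a) \<Rightarrow> bool" where
  "left_nondegenerate X r \<longleftrightarrow> (\<forall>x\<in>X. bij_betw (lambda_map r x) X X)"

definition reflection :: "'a set \<Rightarrow> ('a \<times> 'a \<Rightarrow> 'a \<times> 'a) \<Rightarrow> ('a \<Rightarrow> 'a) \<Rightarrow> bool" where
  "reflection X r \<kappa> \<longleftrightarrow>
     \<kappa> \<in> X \<rightarrow> X \<and>
     (\<forall>t \<in> X \<times> X.
        (r \<circ> map_prod id \<kappa> \<circ> r \<circ> map_prod id \<kappa>) t =
        (map_prod id \<kappa> \<circ> r \<circ> map_prod id \<kappa> \<circ> r) t)"

definition lambda_centralizing :: "'a set \<Rightarrow> ('a \<times> 'a \<Rightarrow> 'a \<times> 'a) \<Rightarrow> ('a \<Rightarrow> 'a) \<Rightarrow> bool" where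
  "lambda_centralizing X r \<kappa> \<longleftrightarrow>
     \<kappa> \<in> X \<rightarrow> X \<and>
     (\<forall>x\<in>X. \<forall>y\<in>X. (lambda_map r x \<circ> \<kappa>) y = (\<kappa> \<circ> lambda_map r x) y)"

text \<open>The operation of the left shelf associated with a left non-degenerate solution;
  \<open>shelf_op X r x\<close> is the left multiplication by \<open>x\<close>.\<close>

definition shelf_op :: "'a set \<Rightarrow> ('a \<times> 'a \<Rightarrow> 'a \<times> 'a) \<Rightarrow> 'a \<Rightarrow> 'a \<Rightarrow> 'a" where
  "shelf_op X r x y = lambda_map r x (rho_map r (inv_into X (lambda_map r y) x) y)"

end

theory Submission
  imports Defs
begin

text \<open>
  The reflection equation is an identity between maps of pairs \<open>(x, y)\<close>. Left non-degeneracy lets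
  the pair \<open>(a, x)\<close> with \<open>a = \<lambda>\<^sub>x(y)\<close> serve as the coordinates instead: for fixed \<open>x\<close> the point \<open>a\<close>
  runs through all of \<open>X\<close>, and \<open>r(x, y)\<close> is the pair \<open>(a, s)\<close> in which \<open>s\<close> is determined by
  \<open>\<lambda>\<^sub>a(s) = L\<^sub>a(x)\<close> (lemma \<open>lambda_rho_eq_shelf_op\<close>). If \<open>\<kappa>\<close> commutes with every \<open>\<lambda>\<^sub>a\<close>, it
  passes through this description, so that \<open>r (id \<times> \<kappa>) r\<close> sends \<open>(x, y)\<close> to the pair \<open>(c, s)\<close> with
  \<open>c = \<kappa> L\<^sub>a(x)\<close> and \<open>\<lambda>\<^sub>c(s) = L\<^sub>c(a)\<close> (lemma \<open>r_kappa_r\<close>).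

  Both sides of the reflection equation are now read off. Precomposing with \<open>id \<times> \<kappa>\<close> replaces \<open>a\<close> by
  \<open>\<kappa>(a)\<close>, and postcomposing with it replaces \<open>L\<^sub>c(a)\<close> by \<open>\<kappa> L\<^sub>c(a)\<close>. Hence the equation
  at \<open>(x, y)\<close> says exactly that \<open>\<kappa> L\<^bsub>\<kappa>(a)\<^esub>(x) = \<kappa> L\<^sub>a(x)\<close> and
  \<open>L\<^sub>c(\<kappa>(a)) = \<kappa> L\<^sub>c(a)\<close>. The first equation, for all \<open>a\<close> and \<open>x\<close>, is condition 1. In its presence
  \<open>\<kappa> L\<^sub>c(a) = \<kappa> L\<^bsub>L\<^sub>a(x)\<^esub>(a)\<close>, because \<open>c = \<kappa> L\<^sub>a(x)\<close>; this turns the second equation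
  into condition 2 at \<open>(a, x)\<close>.
\<close>

lemma lambda_map_in:
  assumes "r \<in> X \<times> X \<rightarrow> X \<times> X" "x \<in> X" "y \<in> X"
  shows "lambda_map r x y \<in> X"
  using funcset_mem[OF assms(1), of "(x, y)"] assms(2,3)
  by (auto simp: lambda_map_def mem_Times_iff)

lemma rho_map_in:
  assumes "r \<in> X \<times> X \<rightarrow> X \<times> X" "x \<in> X" "y \<in> X"
  shows "rho_map r y x \<in> X"
  using funcset_mem[OF assms(1), of "(x, y)"] assms(2,3)
  by (auto simp: rho_map_def mem_Times_iff)

lemma r_eq_lambda_rho: "r (x, y) = (lambda_map r x y, rho_map r y x)"
  by (simp add: lambda_map_def rho_map_def)

lemma lambda_map_eq_iff:
  assumes "left_nondegenerate X r" "x \<in> X" "u \<in> X" "v \<in> X"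
  shows "lambda_map r x u = lambda_map r x v \<longleftrightarrow> u = v"
  using assms unfolding left_nondegenerate_def bij_betw_def by (meson inj_on_eq_iff)

lemma lambda_map_surj:
  assumes "left_nondegenerate X r" "x \<in> X" "a \<in> X"
  obtains y where "y \<in> X" "lambda_map r x y = a"
  using assms unfolding left_nondegenerate_def bij_betw_def by (metis imageE)

lemma lambda_centralizing_commute:
  assumes "lambda_centralizing X r \<kappa>" "x \<in> X" "y \<in> X"
  shows "lambda_map r x (\<kappa> y) = \<kappa> (lambda_map r x y)"
  using assms by (simp add: lambda_centralizing_def)

text \<open>In the definition of \<open>a \<triangleright> x\<close> the inverse of \<open>\<lambda>\<^sub>x\<close> only serves to find the \<open>y\<close> with
  \<open>a = \<lambda>\<^sub>x(y)\<close>. Starting from \<open>y\<close> removes it, and \<open>\<rho>\<close> is recovered from the shelf.\<close>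

lemma lambda_rho_eq_shelf_op:
  assumes "left_nondegenerate X r" "x \<in> X" "y \<in> X"
  shows "lambda_map r (lambda_map r x y) (rho_map r y x) = shelf_op X r (lambda_map r x y) x"
proof -
  have "inv_into X (lambda_map r x) (lambda_map r x y) = y"
    using assms by (simp add: left_nondegenerate_def bij_betw_def inv_into_f_f)
  then show ?thesis
    by (simp add: shelf_op_def)
qed

lemma shelf_op_in:
  assumes "r \<in> X \<times> X \<rightarrow> X \<times> X" "left_nondegenerate X r" "a \<in> X" "x \<in> X"
  shows "shelf_op X r a x \<in> X"
proof -
  obtain y where y: "y \<in> X" "lambda_map r x y = a"
    using lambda_map_surj[OF assms(2,4,3)] .
  show ?thesis
    using lambda_rho_eq_shelf_op[OF assms(2,4) y(1)] y assms
    by (metis lambda_map_in rho_map_in)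
qed

text \<open>Both sides of the reflection equation contain the factor \<open>r (id \<times> \<kappa>) r\<close>. The second component
  is given through its image under \<open>\<lambda>\<^sub>c\<close>, which determines it and on which \<open>\<kappa>\<close> acts well.\<close>

lemma r_kappa_r:
  fixes \<kappa> :: "'a \<Rightarrow> 'a"
  assumes r: "r \<in> X \<times> X \<rightarrow> X \<times> X" and nd: "left_nondegenerate X r"
    and cent: "lambda_centralizing X r \<kappa>" and x: "x \<in> X" and y: "y \<in> X"
  defines "a \<equiv> lambda_map r x y"
  defines "c \<equiv> \<kappa> (shelf_op X r a x)"
  obtains s where "s \<in> X" "r (map_prod id \<kappa> (r (x, y))) = (c, s)"
    "lambda_map r c s = shelf_op X r c a"
proof
  let ?b = "\<kappa> (rho_map r y x)"
  have a: "a \<in> X"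
    using lambda_map_in[OF r x y] by (simp add: a_def)
  have rho: "rho_map r y x \<in> X"
    using rho_map_in[OF r x y] .
  have b: "?b \<in> X"
    using cent rho by (auto simp: lambda_centralizing_def)
  have c: "lambda_map r a ?b = c"
    using lambda_centralizing_commute[OF cent a rho] lambda_rho_eq_shelf_op[OF nd x y]
    by (simp add: a_def c_def)
  show "rho_map r ?b a \<in> X"
    using rho_map_in[OF r a b] .
  show "r (map_prod id \<kappa> (r (x, y))) = (c, rho_map r ?b a)"
    using c by (simp add: r_eq_lambda_rho[of r] a_def)
  show "lambda_map r c (rho_map r ?b a) = shelf_op X r c a"
    using lambda_rho_eq_shelf_op[OF nd a b] c by simp
qed

lemma reflection_equation_at_iff:
  fixes \<kappa> :: "'a \<Rightarrow> 'a"
  assumes r: "r \<in> X \<times> X \<rightarrow> X \<times> X" and nd: "left_nondegenerate X r"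
    and cent: "lambda_centralizing X r \<kappa>" and x: "x \<in> X" and y: "y \<in> X"
  defines "a \<equiv> lambda_map r x y"
  defines "c \<equiv> \<kappa> (shelf_op X r a x)"
  shows "r (map_prod id \<kappa> (r (map_prod id \<kappa> (x, y))))
         = map_prod id \<kappa> (r (map_prod id \<kappa> (r (x, y))))
     \<longleftrightarrow> \<kappa> (shelf_op X r (\<kappa> a) x) = c \<and> shelf_op X r c (\<kappa> a) = \<kappa> (shelf_op X r c a)"
proof -
  have \<kappa>_in: "\<kappa> z \<in> X" if "z \<in> X" for z
    using cent that by (auto simp: lambda_centralizing_def)
  have a: "a \<in> X"
    using lambda_map_in[OF r x y] by (simp add: a_def)
  have c: "c \<in> X"
    using shelf_op_in[OF r nd a x] \<kappa>_in by (simp add: c_def)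
  have \<kappa>a: "lambda_map r x (\<kappa> y) = \<kappa> a"
    using lambda_centralizing_commute[OF cent x y] by (simp add: a_def)
  obtain s where s: "s \<in> X" "r (map_prod id \<kappa> (r (x, y))) = (c, s)"
      "lambda_map r c s = shelf_op X r c a"
    using r_kappa_r[OF r nd cent x y] unfolding a_def c_def by blast
  define c' where "c' = \<kappa> (shelf_op X r (\<kappa> a) x)"
  obtain s' where s': "s' \<in> X" "r (map_prod id \<kappa> (r (x, \<kappa> y))) = (c', s')"
      "lambda_map r c' s' = shelf_op X r c' (\<kappa> a)"
    using r_kappa_r[OF r nd cent x \<kappa>_in[OF y]] unfolding \<kappa>a c'_def by blast
  have "s' = \<kappa> s \<longleftrightarrow> shelf_op X r c (\<kappa> a) = \<kappa> (shelf_op X r c a)" if "c' = c"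
    using lambda_map_eq_iff[OF nd c s'(1) \<kappa>_in[OF s(1)]]
      lambda_centralizing_commute[OF cent c s(1)] s(3) s'(3) that by simp
  then show ?thesis
    using s(2) s'(2) c'_def by auto
qed

theorem theorem2p1:
  fixes X :: "'a set" and r :: "'a \<times> 'a \<Rightarrow> 'a \<times> 'a" and \<kappa> :: "'a \<Rightarrow> 'a"
    and L :: "'a \<Rightarrow> 'a \<Rightarrow> 'a"
  defines "L \<equiv> shelf_op X r"
  assumes "yb_solution X r"
    and "left_nondegenerate X r"
    and "lambda_centralizing X r \<kappa>"
  shows "reflection X r \<kappa> \<longleftrightarrow>
    (\<forall>x\<in>X. \<forall>z\<in>X. (\<kappa> \<circ> L x) z = (\<kappa> \<circ> L (\<kappa> x)) z) \<and>
    (\<forall>x\<in>X. \<forall>y\<in>X. \<kappa> (L (L x y) x) = L (\<kappa> (L x y)) (\<kappa> x))"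
proof -
  have r: "r \<in> X \<times> X \<rightarrow> X \<times> X"
    using assms(2) by (simp add: yb_solution_def)
  note nd = assms(3) and cent = assms(4)
  have L_in: "L a x \<in> X" if "a \<in> X" "x \<in> X" for a x
    using shelf_op_in[OF r nd that] by (simp add: L_def)
  define P where "P a x \<longleftrightarrow> \<kappa> (L (\<kappa> a) x) = \<kappa> (L a x) \<and>
      L (\<kappa> (L a x)) (\<kappa> a) = \<kappa> (L (\<kappa> (L a x)) a)" for a x
  have "reflection X r \<kappa> \<longleftrightarrow> (\<forall>x\<in>X. \<forall>y\<in>X. P (lambda_map r x y) x)"
    using cent reflection_equation_at_iff[OF r nd cent]
    by (simp add: reflection_def lambda_centralizing_def P_def L_def)
  \<comment> \<open>As \<open>\<lambda>\<^sub>x\<close> maps \<open>X\<close> onto \<open>X\<close>, the point \<open>a = \<lambda>\<^sub>x(y)\<close> is arbitrary.\<close>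
  also have "\<dots> \<longleftrightarrow> (\<forall>a\<in>X. \<forall>x\<in>X. P a x)"
    by (metis lambda_map_surj[OF nd] lambda_map_in[OF r])
  \<comment> \<open>Condition 1 at the point \<open>L\<^sub>a(x)\<close> removes a \<open>\<kappa>\<close> from the right-hand side of the second
    equation in \<open>P a x\<close>.\<close>
  also have "\<dots> \<longleftrightarrow> (\<forall>a\<in>X. \<forall>x\<in>X. \<kappa> (L a x) = \<kappa> (L (\<kappa> a) x)) \<and>
      (\<forall>a\<in>X. \<forall>x\<in>X. \<kappa> (L (L a x) a) = L (\<kappa> (L a x)) (\<kappa> a))"
    unfolding P_def using L_in by metis
  finally show ?thesis
    by simp
qed

end
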